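(* Let $1\le k\le m$ be integers and $0<\theta\le1$, and consider the extended occupancy process with $m$ bins and probability parameter $\theta$. Let $T_k=\min\{t\in\{0,1,2,\dots\}: K_{k+t}=k\}$ be the excess hitting time of the occupancy number $k$. Then for every integer $t\ge0$, $$\mathbb{P}(T_k=t)=\operatorname{NegOcc}(t\mid m,k,\theta)=\frac{\theta^{k+t}}{m^{k+t}}\,(m)_k\,S\Big(k+t-1,\,k-1,\,m\cdot\frac{1-\theta}{\theta}\Big).$$
   Context: Extended occupancy process: let $\tilde U_1,\tilde U_2,\dots$ be IID uniform on $\{1,\dots,m\}$ and $Q_1,Q_2,\dots$ be IID Bernoulli$(\theta)$, the two sequences independent of each other. Let $\bullet\notin\{1,\dots,m\}$ and set $U_i=\bullet$ if $Q_i=0$, $U_i=\tilde U_i$ if $Q_i=1$. The occupancy number is $K_n=\sum_{\ell=1}^m\mathbb{I}\big(\sum_{i=1}^n\mathbb{I}(U_i=\ell)>0\big)$. Noncentral Stirling numbers of the second kind: for an integer $n\ge0$ and real $\phi$, the numbers $S(n,k,\phi)$, $0\le k\le n$, are defined by the polynomial identity $(x+\phi)^n=\sum_{k=0}^n S(n,k,\phi)(x)_k$, where $(x)_k=\prod_{i=0}^{k-1}(x-i)$; $S(n,k,\phi)=0$ for $k>n$. Convention $0^0=1$. $\operatorname{NegOcc}(\cdot\mid m,k,\theta)$ (the negative occupancy distribution) is the notation for the explicit right-hand side. *)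

theory Defs
  imports "HOL-Probability.Probability" "HOL-Computational_Algebra.Polynomial"
    "HOL-Library.Extended_Nat"
begin

definition falling_fact :: "'a::comm_ring_1 \<Rightarrow> nat \<Rightarrow> 'a" where
  "falling_fact x k = (\<Prod>i<k. x - of_nat i)"

definition is_nc_stirling_row :: "nat \<Rightarrow> real \<Rightarrow> (nat \<Rightarrow> real) \<Rightarrow> bool" where
  "is_nc_stirling_row n \<phi> s \<longleftrightarrow>
     ([:0, 1:] + [:\<phi>:]) ^ n = (\<Sum>k\<le>n. smult (s k) (falling_fact [:0, 1:] k)) \<and>
     (\<forall>k>n. s k = 0)"

definition nc_stirling :: "nat \<Rightarrow> nat \<Rightarrow> real \<Rightarrow> real" where
  "nc_stirling n k \<phi> = (THE s. is_nc_stirling_row n \<phi> s) k"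

lemma falling_fact_Suc: "falling_fact x (Suc k) = falling_fact x k * (x - of_nat k)"
  by (simp add: falling_fact_def)

lemma poly_falling_fact: "poly (falling_fact [:0, 1:] k) x = falling_fact (x :: real) k"
  by (simp add: falling_fact_def poly_prod)

lemma falling_fact_eq_0: "k < j \<Longrightarrow> falling_fact (real k) j = 0"
  unfolding falling_fact_def by (rule prod_zero) auto

lemma falling_fact_self_nonzero: "falling_fact (real k) k \<noteq> 0"
  by (simp add: falling_fact_def)

lemma nc_stirling_row_unique:
  assumes "is_nc_stirling_row n \<phi> a" and "is_nc_stirling_row n \<phi> b"
  shows "a = b"
proof -
  have eq: "(\<Sum>j\<le>n. a j * falling_fact x j) = (\<Sum>j\<le>n. b j * falling_fact x j)" for x :: real
  proof -
    have "(\<Sum>k\<le>n. smult (a k) (falling_fact [:0, 1:] k)) =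
          (\<Sum>k\<le>n. smult (b k) (falling_fact [:0, 1:] k))"
      using assms by (simp add: is_nc_stirling_row_def)
    from arg_cong[OF this, of "\<lambda>p. poly p x"] show ?thesis
      by (simp add: poly_sum poly_falling_fact)
  qed
  have "a k = b k" if "k \<le> n" for k
    using that
  proof (induction k rule: less_induct)
    case (less k)
    have split: "(\<Sum>j\<le>n. c j * falling_fact (real k) j) =
        (\<Sum>j<k. c j * falling_fact (real k) j) + c k * falling_fact (real k) k" for c :: "nat \<Rightarrow> real"
    proof -
      have "(\<Sum>j\<le>n. c j * falling_fact (real k) j) = (\<Sum>j\<le>k. c j * falling_fact (real k) j)"
        using less.prems by (intro sum.mono_neutral_right) (auto simp: falling_fact_eq_0)
      then show ?thesis by (simp add: lessThan_Suc_atMost[symmetric])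
    qed
    have "(\<Sum>j<k. a j * falling_fact (real k) j) = (\<Sum>j<k. b j * falling_fact (real k) j)"
      using less by (intro sum.cong) auto
    then show ?case
      using eq[of "real k"] split[of a] split[of b] falling_fact_self_nonzero[of k] by simp
  qed
  then show ?thesis
    using assms unfolding is_nc_stirling_row_def by (metis ext not_le)
qed

lemma nc_stirling_row_exists: "\<exists>s. is_nc_stirling_row n \<phi> s"
proof (induction n)
  case 0
  show ?case
    by (rule exI[of _ "\<lambda>k. if k = 0 then 1 else 0"])
       (simp add: is_nc_stirling_row_def falling_fact_def)
next
  case (Suc n)
  then obtain s where s: "is_nc_stirling_row n \<phi> s" by blast
  let ?F = "\<lambda>k. falling_fact [:0, 1 :: real:] k"
  let ?t = "\<lambda>k. (if k = 0 then 0 else s (k - 1)) + (real k + \<phi>) * s k"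
  have step: "?F k * ([:0, 1:] + [:\<phi>:]) = ?F (Suc k) + smult (real k + \<phi>) (?F k)" for k
    by (simp add: falling_fact_Suc of_nat_poly algebra_simps flip: smult_add_left)
  have "([:0, 1:] + [:\<phi>:]) ^ Suc n = (\<Sum>k\<le>n. smult (s k) (?F k)) * ([:0, 1:] + [:\<phi>:])"
    using s by (simp only: is_nc_stirling_row_def power_Suc2)
  also have "\<dots> = (\<Sum>k\<le>n. smult (s k) (?F (Suc k)) + smult ((real k + \<phi>) * s k) (?F k))"
    unfolding sum_distrib_right mult_smult_left step smult_add_right smult_smult
    by (simp only: mult.commute[of _ "s _"])
  also have "\<dots> = (\<Sum>k\<le>n. smult (s k) (?F (Suc k))) + (\<Sum>k\<le>n. smult ((real k + \<phi>) * s k) (?F k))"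
    by (rule sum.distrib)
  also have "(\<Sum>k\<le>n. smult (s k) (?F (Suc k))) =
      (\<Sum>k\<le>Suc n. smult (if k = 0 then 0 else s (k - 1)) (?F k))"
    by (simp add: sum.atMost_Suc_shift del: sum.atMost_Suc)
  also have "(\<Sum>k\<le>n. smult ((real k + \<phi>) * s k) (?F k)) =
      (\<Sum>k\<le>Suc n. smult ((real k + \<phi>) * s k) (?F k))"
    using s by (simp add: is_nc_stirling_row_def)
  finally have "([:0, 1:] + [:\<phi>:]) ^ Suc n = (\<Sum>k\<le>Suc n. smult (?t k) (?F k))"
    by (simp only: smult_add_left sum.distrib)
  moreover have "\<forall>k>Suc n. ?t k = 0"
    using s by (auto simp: is_nc_stirling_row_def)
  ultimately have "is_nc_stirling_row (Suc n) \<phi> ?t"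
    unfolding is_nc_stirling_row_def by blast
  then show ?case by blast
qed

lemma is_nc_stirling_row_nc_stirling: "is_nc_stirling_row n \<phi> (\<lambda>k. nc_stirling n k \<phi>)"
  unfolding nc_stirling_def
  using nc_stirling_row_exists nc_stirling_row_unique by (metis (mono_tags, lifting) theI)

text \<open>The sequences are indexed from 1; the values at index 0 are irrelevant.
  \<open>Q\<close> takes values in \<^typ>\<open>nat\<close> (almost surely 0 or 1) since
  \<open>indep_var\<close> requires both variables to have the same value type.\<close>

locale extended_occupancy = prob_space M
  for M :: "'a measure" +
  fixes m :: nat and \<theta> :: real
    and U :: "nat \<Rightarrow> 'a \<Rightarrow> nat" and Q :: "nat \<Rightarrow> 'a \<Rightarrow> nat"
  assumes U_indep: "indep_vars (\<lambda>_. count_space UNIV) U {1..}"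
    and U_uniform: "\<And>i. i \<ge> 1 \<Longrightarrow> distr M (count_space UNIV) (U i) = measure_pmf (pmf_of_set {1..m})"
    and Q_indep: "indep_vars (\<lambda>_. count_space UNIV) Q {1..}"
    and Q_bernoulli: "\<And>i. i \<ge> 1 \<Longrightarrow>
          distr M (count_space UNIV) (Q i) = measure_pmf (map_pmf of_bool (bernoulli_pmf \<theta>))"
    and UQ_indep: "indep_var
          (Pi\<^sub>M {1..} (\<lambda>_. count_space UNIV)) (\<lambda>\<omega>. \<lambda>i\<in>{1..}. U i \<omega>)
          (Pi\<^sub>M {1..} (\<lambda>_. count_space UNIV)) (\<lambda>\<omega>. \<lambda>i\<in>{1..}. Q i \<omega>)"

text \<open>\<^const>\<open>None\<close> plays the role of the extra symbol outside \<open>{1..m}\<close>.\<close>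

definition thinned :: "(nat \<Rightarrow> 'a \<Rightarrow> nat) \<Rightarrow> (nat \<Rightarrow> 'a \<Rightarrow> nat) \<Rightarrow> nat \<Rightarrow> 'a \<Rightarrow> nat option" where
  "thinned U Q i \<omega> = (if Q i \<omega> = 1 then Some (U i \<omega>) else None)"

definition occupancy ::
    "nat \<Rightarrow> (nat \<Rightarrow> 'a \<Rightarrow> nat) \<Rightarrow> (nat \<Rightarrow> 'a \<Rightarrow> nat) \<Rightarrow> nat \<Rightarrow> 'a \<Rightarrow> nat" where
  "occupancy m U Q n \<omega> =
     (\<Sum>l=1..m. of_bool ((\<Sum>i=1..n. of_bool (thinned U Q i \<omega> = Some l) :: nat) > 0))"

text \<open>The value is \<open>\<infinity>\<close> on the event that occupancy \<open>k\<close> is never reached.\<close>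

definition excess_hitting_time ::
    "nat \<Rightarrow> (nat \<Rightarrow> 'a \<Rightarrow> nat) \<Rightarrow> (nat \<Rightarrow> 'a \<Rightarrow> nat) \<Rightarrow> nat \<Rightarrow> 'a \<Rightarrow> enat" where
  "excess_hitting_time m U Q k \<omega> = Inf (enat ` {t. occupancy m U Q (k + t) \<omega> = k})"

definition NegOcc :: "nat \<Rightarrow> nat \<Rightarrow> nat \<Rightarrow> real \<Rightarrow> real" where
  "NegOcc t m k \<theta> = \<theta> ^ (k + t) / real m ^ (k + t) * falling_fact (real m) k *
     nc_stirling (k + t - 1) (k - 1) (real m * ((1 - \<theta>) / \<theta>))"

end

theory Submission
  imports Defs
begin

text \<open>
  Let \<open>O\<^sub>n\<close> be the set of bins occupied after \<open>n\<close> steps. Since \<open>O\<^sub>n \<subseteq> A\<close> only says that every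
  step is void or hits \<open>A\<close>, independence gives
  \<open>P(O\<^sub>n \<subseteq> A, U\<^sub>n\<^sub>+\<^sub>1 = l) = (\<theta>/m)\<^sup>n\<^sup>+\<^sup>1 (card A + \<phi>)\<^sup>n\<close> with \<open>\<phi> = m (1 - \<theta>)/\<theta>\<close>. Evaluating the
  identity defining the Stirling numbers at \<open>x = card A\<close> and writing \<open>(x)\<^sub>j\<close> as \<open>j!\<close> times the number
  of \<open>j\<close>-subsets of \<open>A\<close>, induction on \<open>A\<close> yields
  \<open>P(O\<^sub>n = A, U\<^sub>n\<^sub>+\<^sub>1 = l) = (\<theta>/m)\<^sup>n\<^sup>+\<^sup>1 j! S(n, j, \<phi>)\<close> for \<open>j = card A\<close>. The event \<open>T\<^sub>k = t\<close> is the
  disjoint union of such events over \<open>card A = k - 1\<close> and \<open>l \<notin> A\<close>, with \<open>n = k + t - 1\<close>.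
\<close>

section \<open>Stirling numbers and sums over subsets\<close>

lemma falling_fact_of_nat: "falling_fact (real n) j = fact j * real (n choose j)"
  by (simp add: falling_fact_def binomial_gbinomial gbinomial_prod_rev atLeast0LessThan)

lemma sum_Pow_card:
  fixes f :: "nat \<Rightarrow> real"
  assumes "finite A"
  shows "(\<Sum>B\<in>Pow A. f (card B)) = (\<Sum>j\<le>card A. real (card A choose j) * f j)"
proof -
  have "(\<Sum>B\<in>Pow A. f (card B)) = (\<Sum>j\<le>card A. \<Sum>B\<in>{B\<in>Pow A. card B = j}. f (card B))"
    using assms by (intro sum.group[symmetric]) (auto intro: card_mono)
  also have "\<dots> = (\<Sum>j\<le>card A. real (card A choose j) * f j)"
    using n_subsets[OF assms] by (intro sum.cong) auto
  finally show ?thesis .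
qed

lemma nc_stirling_eq_0: "n < k \<Longrightarrow> nc_stirling n k \<phi> = 0"
  using is_nc_stirling_row_nc_stirling[of n \<phi>] by (simp add: is_nc_stirling_row_def)

lemma power_eq_sum_nc_stirling:
  "(x + \<phi>) ^ n = (\<Sum>k\<le>n. nc_stirling n k \<phi> * falling_fact x k)"
proof -
  have "poly (([:0, 1:] + [:\<phi>:]) ^ n) x =
      poly (\<Sum>k\<le>n. smult (nc_stirling n k \<phi>) (falling_fact [:0, 1:] k)) x"
    using is_nc_stirling_row_nc_stirling[of n \<phi>] by (simp only: is_nc_stirling_row_def)
  then show ?thesis
    by (simp add: poly_sum poly_falling_fact add.commute)
qed

text \<open>Grouping the subsets by size \<open>j\<close> turns \<open>fact j\<close> times the
  binomial coefficient into \<open>(x)\<^sub>j\<close> at \<open>x = card A\<close>, so the sum is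
  the defining identity of the Stirling numbers at that point.\<close>

lemma sum_subsets_nc_stirling:
  assumes "finite A"
  shows "(\<Sum>B\<in>Pow A. fact (card B) * nc_stirling n (card B) \<phi>) = (real (card A) + \<phi>) ^ n"
proof -
  have "(\<Sum>B\<in>Pow A. fact (card B) * nc_stirling n (card B) \<phi>) =
      (\<Sum>j\<le>card A. nc_stirling n j \<phi> * falling_fact (real (card A)) j)"
    using sum_Pow_card[OF assms, of "\<lambda>j. fact j * nc_stirling n j \<phi>"]
    by (simp add: falling_fact_of_nat mult_ac)
  \<comment> \<open>Either of \<open>n\<close> and \<open>card A\<close> may be the larger: beyond
    \<open>card A\<close> the falling factorial vanishes, beyond \<open>n\<close> the Stirling
    number does.\<close>
  also have "\<dots> = (\<Sum>j\<le>max n (card A). nc_stirling n j \<phi> * falling_fact (real (card A)) j)"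
    by (intro sum.mono_neutral_left) (auto simp: falling_fact_eq_0)
  also have "\<dots> = (\<Sum>j\<le>n. nc_stirling n j \<phi> * falling_fact (real (card A)) j)"
    by (intro sum.mono_neutral_right) (auto simp: nc_stirling_eq_0)
  finally show ?thesis
    by (simp add: power_eq_sum_nc_stirling)
qed

section \<open>The occupied set along a sample path\<close>

definition occupied ::
    "nat \<Rightarrow> (nat \<Rightarrow> 'a \<Rightarrow> nat) \<Rightarrow> (nat \<Rightarrow> 'a \<Rightarrow> nat) \<Rightarrow> nat \<Rightarrow> 'a \<Rightarrow> nat set" where
  "occupied m U Q n \<omega> = {l\<in>{1..m}. \<exists>i\<in>{1..n}. thinned U Q i \<omega> = Some l}"

lemma finite_occupied [simp]: "finite (occupied m U Q n \<omega>)"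
  by (simp add: occupied_def)

lemma occupied_subset: "occupied m U Q n \<omega> \<subseteq> {1..m}"
  by (auto simp: occupied_def)

lemma occupied_0 [simp]: "occupied m U Q 0 \<omega> = {}"
  by (simp add: occupied_def)

lemma occupied_Suc:
  "occupied m U Q (Suc n) \<omega> =
     occupied m U Q n \<omega> \<union> {l\<in>{1..m}. thinned U Q (Suc n) \<omega> = Some l}"
  by (auto simp: occupied_def atLeastAtMostSuc_conv)

lemma occupied_subset_iff:
  assumes "A \<subseteq> {1..m}"
  shows "occupied m U Q n \<omega> \<subseteq> A \<longleftrightarrow> (\<forall>i\<in>{1..n}. U i \<omega> \<in> A \<union> - {1..m} \<or> Q i \<omega> \<noteq> 1)"
  unfolding occupied_def thinned_def by (auto split: if_splits)

lemma occupancy_eq_card: "occupancy m U Q n \<omega> = card (occupied m U Q n \<omega>)"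
proof -
  have "occupancy m U Q n \<omega> = (\<Sum>l=1..m. of_bool (\<exists>i\<in>{1..n}. thinned U Q i \<omega> = Some l))"
    unfolding occupancy_def by (intro sum.cong) (auto simp: sum_eq_0_iff)
  also have "\<dots> = card ({1..m} \<inter> {l. \<exists>i\<in>{1..n}. thinned U Q i \<omega> = Some l})"
    by (simp add: sum_of_bool_eq)
  also have "{1..m} \<inter> {l. \<exists>i\<in>{1..n}. thinned U Q i \<omega> = Some l} = occupied m U Q n \<omega>"
    by (auto simp: occupied_def)
  finally show ?thesis .
qed

lemma occupancy_Suc:
  "occupancy m U Q (Suc n) \<omega> = occupancy m U Q n \<omega> +
     of_bool (\<exists>l\<in>{1..m} - occupied m U Q n \<omega>. thinned U Q (Suc n) \<omega> = Some l)"
proof (cases "\<exists>l\<in>{1..m} - occupied m U Q n \<omega>. thinned U Q (Suc n) \<omega> = Some l")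
  case True
  then obtain l where l: "l \<in> {1..m} - occupied m U Q n \<omega>" "thinned U Q (Suc n) \<omega> = Some l"
    by blast
  then have "occupied m U Q (Suc n) \<omega> = insert l (occupied m U Q n \<omega>)"
    by (auto simp: occupied_Suc)
  then show ?thesis
    using l True by (simp add: occupancy_eq_card)
next
  case False
  then have "occupied m U Q (Suc n) \<omega> = occupied m U Q n \<omega>"
    by (auto simp: occupied_Suc)
  then show ?thesis
    using False by (simp only: occupancy_eq_card of_bool_eq add_0_right)
qed

lemma occupancy_le: "occupancy m U Q n \<omega> \<le> n"
proof (induction n)
  case 0
  then show ?case by (simp add: occupancy_eq_card)
next
  case (Suc n)
  then show ?case by (simp add: occupancy_Suc of_bool_def)
qed

lemma occupancy_mono: "n \<le> n' \<Longrightarrow> occupancy m U Q n \<omega> \<le> occupancy m U Q n' \<omega>"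
  by (rule lift_Suc_mono_le[of "\<lambda>n. occupancy m U Q n \<omega>"]) (simp_all add: occupancy_Suc)

section \<open>Hitting times along a sample path\<close>

lemma Inf_enat_image_eq_iff:
  "Inf (enat ` S) = enat t \<longleftrightarrow> t \<in> S \<and> (\<forall>s\<in>S. t \<le> s)"
proof
  assume *: "Inf (enat ` S) = enat t"
  \<comment> \<open>The infimum of the empty set is \<infinity>, so a finite value forces
    \<open>S\<close> to be nonempty.\<close>
  then have "S \<noteq> {}" by (auto simp: Inf_enat_def)
  then have "Inf (enat ` S) \<in> enat ` S"
    unfolding Inf_enat_def by (auto intro: LeastI)
  moreover have "enat t \<le> enat s" if "s \<in> S" for s
    using that unfolding *[symmetric] by (intro Inf_lower) auto
  ultimately show "t \<in> S \<and> (\<forall>s\<in>S. t \<le> s)"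
    using * by auto
next
  assume "t \<in> S \<and> (\<forall>s\<in>S. t \<le> s)"
  then show "Inf (enat ` S) = enat t"
    by (intro antisym Inf_lower Inf_greatest) auto
qed

text \<open>The occupancy grows by at most one per step, so \<open>k\<close> is first reached when it jumps from
  \<open>k - 1\<close>; as it is at most \<open>n\<close> at time \<open>n\<close>, starting to look at time \<open>k\<close> misses nothing.\<close>

lemma excess_hitting_time_eq_iff:
  "excess_hitting_time m U Q (Suc j) \<omega> = enat t \<longleftrightarrow>
     card (occupied m U Q (j + t) \<omega>) = j \<and>
     (\<exists>l\<in>{1..m} - occupied m U Q (j + t) \<omega>. thinned U Q (Suc (j + t)) \<omega> = Some l)"
proof -
  let ?K = "\<lambda>n. occupancy m U Q n \<omega>"
  have "excess_hitting_time m U Q (Suc j) \<omega> = enat t \<longleftrightarrow>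
      ?K (Suc (j + t)) = Suc j \<and> (\<forall>s. ?K (Suc (j + s)) = Suc j \<longrightarrow> t \<le> s)"
    by (simp add: excess_hitting_time_def Inf_enat_image_eq_iff)
  also have "\<dots> \<longleftrightarrow> ?K (Suc (j + t)) = Suc j \<and> ?K (j + t) = j"
  proof (intro conj_cong refl iffI allI impI)
    assume K: "?K (Suc (j + t)) = Suc j"
    {
      assume first: "\<forall>s. ?K (Suc (j + s)) = Suc j \<longrightarrow> t \<le> s"
      have "?K (j + t) \<noteq> Suc j"
      proof (cases t)
        case 0
        then show ?thesis using occupancy_le[of m U Q j \<omega>] by simp
      next
        case (Suc s)
        \<comment> \<open>Here \<open>j + t = Suc (j + s)\<close>, so occupancy \<open>Suc j\<close>
          at that time would be a hit at excess \<open>s < t\<close>.\<close>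
        then show ?thesis using first[rule_format, of s] by auto
      qed
      then show "?K (j + t) = j"
        using K by (auto simp: occupancy_Suc of_bool_def split: if_splits)
    }
    fix s assume "?K (j + t) = j" "?K (Suc (j + s)) = Suc j"
    \<comment> \<open>If \<open>s < t\<close>, then \<open>Suc (j + s) \<le> j + t\<close>, and
      monotonicity would give \<open>Suc j \<le> j\<close>.\<close>
    then show "t \<le> s"
      using occupancy_mono[of "Suc (j + s)" "j + t" m U Q \<omega>] by force
  qed
  also have "\<dots> \<longleftrightarrow> card (occupied m U Q (j + t) \<omega>) = j \<and>
     (\<exists>l\<in>{1..m} - occupied m U Q (j + t) \<omega>. thinned U Q (Suc (j + t)) \<omega> = Some l)"
    unfolding occupancy_Suc of_bool_def occupancy_eq_card[of m U Q "j + t"] by auto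
  finally show ?thesis .
qed

section \<open>Independence of the steps\<close>

context extended_occupancy
begin

lemma measurable_U [measurable]: "i \<ge> 1 \<Longrightarrow> U i \<in> measurable M (count_space UNIV)"
  using U_indep by (simp add: indep_vars_def)

lemma measurable_Q [measurable]: "i \<ge> 1 \<Longrightarrow> Q i \<in> measurable M (count_space UNIV)"
  using Q_indep by (simp add: indep_vars_def)

lemma prob_U:
  assumes "1 \<le> i" "1 \<le> m"
  shows "prob {\<omega>\<in>space M. U i \<omega> \<in> C} = card ({1..m} \<inter> C) / m"
proof -
  have "prob {\<omega>\<in>space M. U i \<omega> \<in> C} = measure (distr M (count_space UNIV) (U i)) C"
    using assms by (subst measure_distr) (auto simp: vimage_def Int_def conj_commute)
  then show ?thesis
    using assms by (simp add: U_uniform measure_pmf_of_set)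
qed

lemma prob_Q:
  assumes "1 \<le> i" "0 \<le> \<theta>" "\<theta> \<le> 1"
  shows "prob {\<omega>\<in>space M. Q i \<omega> = 1} = \<theta>"
proof -
  have "prob {\<omega>\<in>space M. Q i \<omega> = 1} = measure (distr M (count_space UNIV) (Q i)) {1}"
    using assms by (subst measure_distr) (auto simp: vimage_def Int_def conj_commute)
  also have "\<dots> = measure (bernoulli_pmf \<theta>) {True}"
  proof -
    have "(of_bool :: bool \<Rightarrow> nat) -` {1} = {True}" by (auto simp: of_bool_def split: if_splits)
    then show ?thesis using assms by (simp only: Q_bernoulli measure_map_pmf)
  qed
  finally show ?thesis
    using assms by (simp add: measure_pmf_single)
qed

text \<open>Rectangles for the pair of \<open>U i\<close> and \<open>Q i\<close>: an
  intersection-stable family generating the events of step \<open>i\<close>, on which probabilities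
  factor.\<close>

definition rect :: "nat \<Rightarrow> nat set \<Rightarrow> nat set \<Rightarrow> 'a set" where
  "rect i C D = {\<omega>\<in>space M. U i \<omega> \<in> C \<and> Q i \<omega> \<in> D}"

lemma rect_sets: "i \<ge> 1 \<Longrightarrow> rect i C D \<in> events"
  unfolding rect_def by measurable

text \<open>Independence of the two whole sequences separates \<open>U\<close> from
  \<open>Q\<close>; independence inside each sequence then splits either factor.\<close>

lemma prob_Inter_rect:
  assumes J: "J \<subseteq> {1..}" "finite J" "J \<noteq> {}"
  shows "prob (\<Inter>j\<in>J. rect j (C j) (D j)) =
    (\<Prod>j\<in>J. prob {\<omega>\<in>space M. U j \<omega> \<in> C j}) * (\<Prod>j\<in>J. prob {\<omega>\<in>space M. Q j \<omega> \<in> D j})"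
proof -
  let ?P = "Pi\<^sub>M {1..} (\<lambda>_. count_space UNIV :: nat measure)"
  \<comment> \<open>Cylinder sets in sequence space, since \<open>UQ_indep\<close> speaks of entire
    sequences and not of finitely many coordinates.\<close>
  let ?S = "\<lambda>C :: nat \<Rightarrow> nat set. {f\<in>space ?P. \<forall>j\<in>J. f j \<in> C j}"
  have S: "?S C \<in> sets ?P" for C
    using J(2) by measurable (use J(1) in auto)
  have pre: "(\<lambda>\<omega>. \<lambda>i\<in>{1..}. X i \<omega>) -` ?S C \<inter> space M = (\<Inter>j\<in>J. X j -` C j \<inter> space M)"
    for X :: "nat \<Rightarrow> 'a \<Rightarrow> nat" and C
    using J by (auto simp: space_PiM)
  have "(\<lambda>\<omega>. (\<lambda>i\<in>{1..}. U i \<omega>, \<lambda>i\<in>{1..}. Q i \<omega>)) -` (?S C \<times> ?S D) \<inter> space M =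
      ((\<lambda>\<omega>. \<lambda>i\<in>{1..}. U i \<omega>) -` ?S C \<inter> space M) \<inter> ((\<lambda>\<omega>. \<lambda>i\<in>{1..}. Q i \<omega>) -` ?S D \<inter> space M)"
    by blast
  also have "\<dots> = (\<Inter>j\<in>J. rect j (C j) (D j))"
    unfolding pre rect_def using J(3) by blast
  finally have "prob (\<Inter>j\<in>J. rect j (C j) (D j)) =
      prob ((\<lambda>\<omega>. (\<lambda>i\<in>{1..}. U i \<omega>, \<lambda>i\<in>{1..}. Q i \<omega>)) -` (?S C \<times> ?S D) \<inter> space M)"
    by simp
  also have "\<dots> = prob ((\<lambda>\<omega>. \<lambda>i\<in>{1..}. U i \<omega>) -` ?S C \<inter> space M) *
      prob ((\<lambda>\<omega>. \<lambda>i\<in>{1..}. Q i \<omega>) -` ?S D \<inter> space M)"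
    using indep_varD[OF UQ_indep S S] .
  also have "\<dots> = (\<Prod>j\<in>J. prob (U j -` C j \<inter> space M)) * (\<Prod>j\<in>J. prob (Q j -` D j \<inter> space M))"
    unfolding pre using J
    by (intro arg_cong2[of _ _ _ _ "(*)"] indep_varsD[OF U_indep] indep_varsD[OF Q_indep]) auto
  finally show ?thesis
    by (simp add: vimage_def Int_def conj_commute)
qed

lemma prob_rect:
  assumes "i \<ge> 1"
  shows "prob (rect i C D) = prob {\<omega>\<in>space M. U i \<omega> \<in> C} * prob {\<omega>\<in>space M. Q i \<omega> \<in> D}"
  using prob_Inter_rect[of "{i}" "\<lambda>_. C" "\<lambda>_. D"] assms by simp

lemma indep_rect: "indep_sets (\<lambda>i. {rect i C D | C D. True}) {1..}"
proof (rule indep_setsI)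
  fix A J assume J: "J \<noteq> {}" "J \<subseteq> {1::nat..}" "finite J"
    and "\<forall>j\<in>J. A j \<in> {rect j C D | C D. True}"
  then have "\<forall>j\<in>J. \<exists>C D. A j = rect j C D" by auto
  then obtain C D where A: "\<forall>j\<in>J. A j = rect j (C j) (D j)" by metis
  have "prob (\<Inter>j\<in>J. A j) = prob (\<Inter>j\<in>J. rect j (C j) (D j))"
    using A by simp
  also have "\<dots> = (\<Prod>j\<in>J. prob (rect j (C j) (D j)))"
    using J by (subst prob_Inter_rect)
      (auto simp: prod.distrib[symmetric] intro!: prod.cong prob_rect[symmetric])
  finally show "prob (\<Inter>j\<in>J. A j) = (\<Prod>j\<in>J. prob (A j))"
    using A by simp
qed (auto intro: rect_sets)

text \<open>The event that a step is void or hits \<open>A\<close> is a union of rectangles and in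
  general not a rectangle. As rectangles are closed under intersection, independence passes to the
  sigma-algebras they generate.\<close>

lemma indep_steps: "indep_sets (\<lambda>i. sigma_sets (space M) {rect i C D | C D. True}) {1..}"
proof (rule indep_sets_sigma[OF indep_rect])
  fix i
  have "rect i C D \<inter> rect i C' D' = rect i (C \<inter> C') (D \<inter> D')" for C C' D D'
    by (auto simp: rect_def)
  then show "Int_stable {rect i C D | C D. True}"
    unfolding Int_stable_def by blast
qed

section \<open>The law of the occupied set\<close>

lemma measurable_thinned [measurable]:
  "i \<ge> 1 \<Longrightarrow> thinned U Q i \<in> measurable M (count_space UNIV)"
  unfolding thinned_def[abs_def] by measurable

lemma occupied_eq_sets:
  "{\<omega>\<in>space M. occupied m U Q n \<omega> = B \<and> thinned U Q (Suc n) \<omega> = Some l} \<in> events"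
proof -
  have eq: "occupied m U Q n \<omega> = B \<longleftrightarrow>
      B \<subseteq> {1..m} \<and> (\<forall>l\<in>{1..m}. l \<in> B \<longleftrightarrow> (\<exists>i\<in>{1..n}. thinned U Q i \<omega> = Some l))" for \<omega>
    unfolding occupied_def by blast
  show ?thesis
    unfolding eq by measurable
qed

lemma prob_occupied_subset:
  assumes A: "A \<subseteq> {1..m}" and l: "l \<in> {1..m}" and \<theta>: "0 < \<theta>" "\<theta> \<le> 1"
  shows "prob {\<omega>\<in>space M. occupied m U Q n \<omega> \<subseteq> A \<and> thinned U Q (Suc n) \<omega> = Some l} =
    (\<theta> / m) ^ Suc n * (real (card A) + m * ((1 - \<theta>) / \<theta>)) ^ n"
proof -
  have m: "1 \<le> m" using l by auto
  let ?C = "A \<union> - {1..m}"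
  \<comment> \<open>Step \<open>Suc n\<close> must hit \<open>l\<close>; an earlier step hits
    \<open>?C\<close> or is void. The void case is \<open>- {1}\<close> because
    \<open>thinned\<close> discards every value of \<open>Q\<close> other than 1.\<close>
  define E where "E i =
      (if i = Suc n then rect i {l} {1} else rect i ?C {1} \<union> rect i UNIV (- {1}))" for i
  have E_sigma: "E i \<in> sigma_sets (space M) {rect i C D | C D. True}" for i
    unfolding E_def by (cases "i = Suc n") (auto intro!: sigma_sets_Un intro: sigma_sets.Basic)
  have last: "prob (E (Suc n)) = \<theta> / m"
    using m l \<theta> prob_U[of "Suc n" "{l}"] prob_Q[of "Suc n"] by (simp add: E_def prob_rect)
  have step: "prob (E i) = \<theta> / m * (real (card A) + m * ((1 - \<theta>) / \<theta>))" if i: "i \<in> {1..n}" for i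
  proof -
    have "prob (E i) = prob (rect i ?C {1}) + prob (rect i UNIV (- {1}))"
      using i by (auto simp: E_def intro!: finite_measure_Union rect_sets) (auto simp: rect_def)
    moreover have "prob {\<omega>\<in>space M. Q i \<omega> \<noteq> 1} = 1 - \<theta>"
      using i \<theta> prob_Q[of i] by (subst prob_neg) auto
    moreover have "{1..m} \<inter> ?C = A" using A by auto
    then have "prob {\<omega>\<in>space M. U i \<omega> \<in> ?C} = card A / m"
      using i m prob_U[of i ?C] by simp
    ultimately have "prob (E i) = card A / m * \<theta> + (1 - \<theta>)"
      using i \<theta> prob_Q[of i] by (simp add: prob_rect prob_space del: Un_iff)
    \<comment> \<open>Factoring out \<open>\<theta> / m\<close> is what produces the shift
      \<open>m * ((1 - \<theta>) / \<theta>)\<close>.\<close>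
    moreover have "\<theta> / m * (real (card A) + m * ((1 - \<theta>) / \<theta>)) = card A / m * \<theta> + (1 - \<theta>)"
      using m \<theta> by (simp add: field_simps)
    ultimately show ?thesis by simp
  qed
  have "{\<omega>\<in>space M. occupied m U Q n \<omega> \<subseteq> A \<and> thinned U Q (Suc n) \<omega> = Some l} =
      (\<Inter>i\<in>{1..Suc n}. E i)"
  proof -
    have "(\<Inter>i\<in>{1..Suc n}. E i) = E (Suc n) \<inter> (\<Inter>i\<in>{1..n}. E i)"
      by (simp add: atLeastAtMostSuc_conv)
    also have "\<dots> = rect (Suc n) {l} {1} \<inter> (\<Inter>i\<in>{1..n}. rect i ?C {1} \<union> rect i UNIV (- {1}))"
      by (simp add: E_def)
    also have "\<dots> = {\<omega>\<in>space M. occupied m U Q n \<omega> \<subseteq> A \<and> thinned U Q (Suc n) \<omega> = Some l}"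
      unfolding occupied_subset_iff[OF A]
      by (auto simp: rect_def thinned_def simp del: One_nat_def split: if_splits)
    finally show ?thesis ..
  qed
  then have "prob {\<omega>\<in>space M. occupied m U Q n \<omega> \<subseteq> A \<and> thinned U Q (Suc n) \<omega> = Some l} =
      (\<Prod>i\<in>{1..Suc n}. prob (E i))"
    using indep_setsD[OF indep_steps, of "{1..Suc n}" E] E_sigma by auto
  also have "\<dots> = (\<Prod>i\<in>{1..n}. prob (E i)) * prob (E (Suc n))"
    by simp
  also have "\<dots> = (\<theta> / m * (real (card A) + m * ((1 - \<theta>) / \<theta>))) ^ n * (\<theta> / m)"
    using step last by simp
  finally show ?thesis
    by (simp only: power_mult_distrib power_Suc mult_ac)
qed

text \<open>Both sides have the same sum over all subsets of \<open>A\<close>, and by induction the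
  terms at proper subsets cancel, leaving the term at \<open>A\<close>: Moebius inversion without
  signs.\<close>

lemma prob_occupied_eq:
  assumes "A \<subseteq> {1..m}" and l: "l \<in> {1..m}" and \<theta>: "0 < \<theta>" "\<theta> \<le> 1"
  shows "prob {\<omega>\<in>space M. occupied m U Q n \<omega> = A \<and> thinned U Q (Suc n) \<omega> = Some l} =
    (\<theta> / m) ^ Suc n * (fact (card A) * nc_stirling n (card A) (m * ((1 - \<theta>) / \<theta>)))"
    (is "?p A = ?f A")
proof -
  have "finite A" using assms(1) finite_subset by blast
  then show ?thesis using assms(1)
  proof (induction A rule: finite_psubset_induct)
    case (psubset A)
    have rest: "(\<Sum>B\<in>Pow A - {A}. ?p B) = (\<Sum>B\<in>Pow A - {A}. ?f B)"
      using psubset by (intro sum.cong) auto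
    have "(\<Sum>B\<in>Pow A. ?p B) =
        prob (\<Union>B\<in>Pow A. {\<omega>\<in>space M. occupied m U Q n \<omega> = B \<and> thinned U Q (Suc n) \<omega> = Some l})"
      using psubset.hyps
      by (intro finite_measure_finite_Union[symmetric])
         (auto simp: disjoint_family_on_def intro!: occupied_eq_sets)
    also have "\<dots> = prob {\<omega>\<in>space M. occupied m U Q n \<omega> \<subseteq> A \<and> thinned U Q (Suc n) \<omega> = Some l}"
      by (intro arg_cong[of _ _ prob]) auto
    also have "\<dots> = (\<Sum>B\<in>Pow A. ?f B)"
      unfolding prob_occupied_subset[OF psubset.prems l \<theta>] sum_distrib_left[symmetric]
      using psubset.hyps by (simp only: sum_subsets_nc_stirling)
    finally show ?case
      using rest psubset.hyps
        sum.remove[of "Pow A" A ?p] sum.remove[of "Pow A" A ?f] by simp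
  qed
qed

section \<open>The law of the excess hitting time\<close>

lemma prob_excess_hitting_time:
  assumes \<theta>: "0 < \<theta>" "\<theta> \<le> 1" and j: "j < m"
  shows "prob {\<omega>\<in>space M. excess_hitting_time m U Q (Suc j) \<omega> = enat t} = NegOcc t m (Suc j) \<theta>"
proof -
  let ?n = "j + t"
  let ?s = "nc_stirling ?n j (m * ((1 - \<theta>) / \<theta>))"
  \<comment> \<open>\<open>A\<close> is the set occupied just before the hit and \<open>l\<close>
    the new bin; the outcome determines both, so the events are disjoint.\<close>
  let ?I = "SIGMA A:{A. A \<subseteq> {1..m} \<and> card A = j}. {1..m} - A"
  let ?E = "\<lambda>(A, l). {\<omega>\<in>space M. occupied m U Q ?n \<omega> = A \<and> thinned U Q (Suc ?n) \<omega> = Some l}"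
  have fin: "finite {A. A \<subseteq> {1..m} \<and> card A = j}" by simp
  have card_diff: "card ({1..m} - A) = m - card A" if "A \<subseteq> {1..m}" for A
    using that by (subst card_Diff_subset) (auto intro: finite_subset)
  have "card ?I = (\<Sum>A\<in>{A. A \<subseteq> {1..m} \<and> card A = j}. m - j)"
    using card_diff by (subst card_SigmaI[OF fin]) (auto intro!: sum.cong)
  then have card_I: "card ?I = (m choose j) * (m - j)"
    using n_subsets[of "{1..m}" j] by simp
  have "{\<omega>\<in>space M. excess_hitting_time m U Q (Suc j) \<omega> = enat t} = (\<Union>x\<in>?I. ?E x)"
    unfolding excess_hitting_time_eq_iff using occupied_subset by fastforce
  then have "prob {\<omega>\<in>space M. excess_hitting_time m U Q (Suc j) \<omega> = enat t} =
      prob (\<Union>x\<in>?I. ?E x)"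
    by (rule arg_cong)
  also have "\<dots> = (\<Sum>x\<in>?I. prob (?E x))"
  proof (rule finite_measure_finite_Union)
    show "finite ?I" using fin by (intro finite_SigmaI) auto
    show "?E ` ?I \<subseteq> events" by (rule image_subsetI) (use occupied_eq_sets in auto)
    show "disjoint_family_on ?E ?I"
    proof (unfold disjoint_family_on_def, intro ballI impI equals0I)
      fix x y \<omega> assume "x \<noteq> y" "\<omega> \<in> ?E x \<inter> ?E y"
      moreover from this have "x = y" by (cases x; cases y) simp
      ultimately show False by blast
    qed
  qed
  also have "\<dots> = (\<Sum>x\<in>?I. (\<theta> / m) ^ Suc ?n * (fact j * ?s))"
  proof (intro sum.cong refl)
    fix x assume "x \<in> ?I"
    moreover obtain A l where x: "x = (A, l)" by (cases x)
    ultimately have A: "A \<subseteq> {1..m}" "card A = j" and l: "l \<in> {1..m}" by auto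
    show "prob (?E x) = (\<theta> / m) ^ Suc ?n * (fact j * ?s)"
      using prob_occupied_eq[OF A(1) l \<theta>, of ?n] unfolding x A(2) prod.case .
  qed
  also have "\<dots> = (\<theta> / m) ^ Suc ?n * (fact j * real (m choose j) * (real m - real j)) * ?s"
    using card_I j by (simp add: of_nat_diff)
  \<comment> \<open>\<open>fact j * (m choose j)\<close> is \<open>(m)\<^sub>j\<close>, and the
    choice of \<open>l\<close> supplies the last factor \<open>m - j\<close> of
    \<open>(m)\<^sub>j\<^sub>+\<^sub>1\<close>.\<close>
  also have "\<dots> = (\<theta> / m) ^ Suc ?n * falling_fact (real m) (Suc j) * ?s"
    by (simp only: falling_fact_Suc falling_fact_of_nat)
  finally show ?thesis
    by (simp add: NegOcc_def power_divide)
qed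

end

theorem mainTheorem4:
  fixes M :: "'a measure" and m k t :: nat and \<theta> :: real
    and U :: "nat \<Rightarrow> 'a \<Rightarrow> nat" and Q :: "nat \<Rightarrow> 'a \<Rightarrow> nat"
  assumes "1 \<le> k" and "k \<le> m" and "0 < \<theta>" and "\<theta> \<le> 1"
    and "extended_occupancy M m \<theta> U Q"
  shows "measure M {\<omega> \<in> space M. excess_hitting_time m U Q k \<omega> = enat t} = NegOcc t m k \<theta> \<and>
    NegOcc t m k \<theta> = \<theta> ^ (k + t) / real m ^ (k + t) * falling_fact (real m) k *
      nc_stirling (k + t - 1) (k - 1) (real m * ((1 - \<theta>) / \<theta>))"
proof -
  interpret extended_occupancy M m \<theta> U Q by fact
  \<comment> \<open>With \<open>k = Suc j\<close> the truncated differences \<open>k + t - 1\<close>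
    and \<open>k - 1\<close> become \<open>j + t\<close> and \<open>j\<close>.\<close>
  obtain j where "k = Suc j" using assms(1) by (cases k) auto
  then show ?thesis
    using prob_excess_hitting_time[of j t] assms by (simp add: NegOcc_def)
qed

end
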